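(* There is a universal constant $c>0$ such that the following holds. Let $\mathscr X\subset\mathbb R^d$ be a closed bounded convex set with diameter $D>0$, and let $\sigma,\Sigma>0$. For all sufficiently large $T$ and for any learning algorithm, there exist a function $f:\mathscr X\times\Xi\to\mathbb R$ and a sequence of distributions $\mathscr D_1,\dots,\mathscr D_T$ on $\Xi$ chosen by the adversary, satisfying assumptions (A1), (A2), (A3) of the context (for some finite constants $G,L$), with $\bar\sigma_T\ge\sigma$ and $\bar\Sigma_T\ge\Sigma$, and a point $u\in\mathscr X$, such that $$\mathbb E[R_T(u)]\ \ge\ c\,D\left(\bar\sigma_T+\bar\Sigma_T\right)\sqrt T .$$
   Context: Stochastically extended adversarial (SEA) protocol: $\mathscr X\subset\mathbb R^d$ is closed, bounded and convex, $\Xi$ is a measurable space, $f:\mathscr X\times\Xi\to\mathbb R$, and $\nabla f(x,\xi)$ is the gradient in $x$. In each round $t=1,\dots,T$ the learner chooses $x_t\in\mathscr X$ (based on past observations), the adversary picks a distribution $\mathscr D_t$ on $\Xi$ (possibly depending on past actions and realizations), a sample $\xi_t\sim\mathscr D_t$ is observed by both, and the learner suffers loss $f(x_t,\xi_t)$. $\mathbb E$ is the expectation over the joint law of $(x_1,\xi_1,\dots,x_T,\xi_T)$. For a distribution $\mathscr D$ let $F^{\mathscr D}(x)=\mathbb E_{\xi\sim\mathscr D}[f(x,\xi)]$, $\nabla F^{\mathscr D}(x)=\mathbb E_{\xi\sim\mathscr D}[\nabla f(x,\xi)]$ and $\sigma_{\mathscr D}^2=\max_{x\in\mathscr X}\mathbb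 E_{\xi\sim\mathscr D}\|\nabla f(x,\xi)-\nabla F^{\mathscr D}(x)\|^2$ (Euclidean norm). Write $F^t=F^{\mathscr D_t}$, $\sigma_t^2=\sigma_{\mathscr D_t}^2$, with the convention $F^0:=F^1$. Define $$\bar\sigma_T^2=\frac1T\,\mathbb E\Big[\sum_{t=1}^T\sigma_t^2\Big],\qquad \bar\Sigma_T^2=\frac1T\,\mathbb E\Big[\sum_{t=1}^T\sup_{x\in\mathscr X}\|\nabla F^t(x)-\nabla F^{t-1}(x)\|^2\Big].$$ Assumptions, for every distribution $\mathscr D$ used by the adversary: (A1) for $\xi\sim\mathscr D$, almost surely $f(\cdot,\xi)$ is convex and its gradients on $\mathscr X$ are bounded in norm by $G$; (A2) $\nabla F^{\mathscr D}$ is $L$-Lipschitz on $\mathscr X$; (A3) $\mathbb E_{\xi\sim\mathscr D}\|\nabla f(x,\xi)-\nabla F^{\mathscr D}(x)\|^2<\infty$ for every $x\in\mathscr X$. Regret: $R_T(u)=\sum_{t=1}^T\langle g_t,x_t-u\rangle$ with $g_t=\nabla f(x_t,\xi_t)$, $u\in\mathscr X$. *)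

theory Defs
  imports "HOL-Probability.Probability"
begin

section \<open>Losses\<close>

text \<open>
  A loss is a total function \<open>f x \<xi>\<close>; gradients are gradients in the ambient Euclidean space
  (also at boundary points of the domain), so they are unique where they exist.
\<close>

definition grad :: "('a::euclidean_space \<Rightarrow> 'xi \<Rightarrow> real) \<Rightarrow> 'a \<Rightarrow> 'xi \<Rightarrow> 'a" where
  "grad f x \<xi> = (THE v. GDERIV (\<lambda>y. f y \<xi>) x :> v)"

definition mean_grad :: "('a::euclidean_space \<Rightarrow> 'xi \<Rightarrow> real) \<Rightarrow> 'xi measure \<Rightarrow> 'a \<Rightarrow> 'a" where
  "mean_grad f \<D> x = (\<integral>\<xi>. grad f x \<xi> \<partial>\<D>)"

definition grad_variance ::
  "'a::euclidean_space set \<Rightarrow> ('a \<Rightarrow> 'xi \<Rightarrow> real) \<Rightarrow> 'xi measure \<Rightarrow> real" where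
  "grad_variance X f \<D> = (SUP x\<in>X. \<integral>\<xi>. (norm (grad f x \<xi> - mean_grad f \<D> x))\<^sup>2 \<partial>\<D>)"

definition differentiable_loss ::
  "'a::euclidean_space set \<Rightarrow> 'xi measure \<Rightarrow> ('a \<Rightarrow> 'xi \<Rightarrow> real) \<Rightarrow> bool" where
  "differentiable_loss X \<Xi> f \<longleftrightarrow>
     (\<forall>x\<in>X. \<forall>\<xi>\<in>space \<Xi>. \<exists>v. GDERIV (\<lambda>y. f y \<xi>) x :> v)"

text \<open>
  The first conjunct says that the expectations defining \<open>F\<^sup>\<D>(x)\<close> and its gradient exist,
  which is needed for the remaining conjuncts to be meaningful.
\<close>

definition admissible ::
  "'a::euclidean_space set \<Rightarrow> ('a \<Rightarrow> 'xi \<Rightarrow> real) \<Rightarrow> real \<Rightarrow> real \<Rightarrow> 'xi measure \<Rightarrow> bool" where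
  "admissible X f G L \<D> \<longleftrightarrow>
     (\<forall>x\<in>X. integrable \<D> (f x) \<and> integrable \<D> (grad f x)) \<and>
     (AE \<xi> in \<D>. convex_on X (\<lambda>x. f x \<xi>) \<and> (\<forall>x\<in>X. norm (grad f x \<xi>) \<le> G)) \<and>
     L-lipschitz_on X (mean_grad f \<D>) \<and>
     (\<forall>x\<in>X. integrable \<D> (\<lambda>\<xi>. (norm (grad f x \<xi> - mean_grad f \<D> x))\<^sup>2))"


section \<open>The protocol\<close>

text \<open>
  Rounds are numbered \<open>0, \<dots>, T - 1\<close>. A play \<open>\<omega>\<close> assigns to each round \<open>t\<close> the pair
  \<open>\<omega> t = (x\<^sub>t, \<xi>\<^sub>t)\<close>.
\<close>

definition round_space :: "'a::euclidean_space set \<Rightarrow> 'xi measure \<Rightarrow> ('a \<times> 'xi) measure" where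
  "round_space X \<Xi> = restrict_space borel X \<Otimes>\<^sub>M \<Xi>"

definition history :: "'a::euclidean_space set \<Rightarrow> 'xi measure \<Rightarrow> nat \<Rightarrow> (nat \<Rightarrow> 'a \<times> 'xi) measure" where
  "history X \<Xi> t = (\<Pi>\<^sub>M i\<in>{0..<t}. round_space X \<Xi>)"

text \<open>
  Both players use Markov kernels on the history of the rounds before \<open>t\<close>: the learner's kernel
  gives the law of its (possibly randomized) point \<open>x\<^sub>t\<close>, the adversary's kernel is the
  distribution \<open>\<D>\<^sub>t\<close> itself.
\<close>

definition learner_strategy ::
  "'a::euclidean_space set \<Rightarrow> 'xi measure \<Rightarrow> (nat \<Rightarrow> (nat \<Rightarrow> 'a \<times> 'xi) \<Rightarrow> 'a measure) \<Rightarrow> bool" where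
  "learner_strategy X \<Xi> \<A> \<longleftrightarrow>
     (\<forall>t. \<A> t \<in> history X \<Xi> t \<rightarrow>\<^sub>M prob_algebra (restrict_space borel X))"

definition adversary_strategy ::
  "'a::euclidean_space set \<Rightarrow> 'xi measure \<Rightarrow> (nat \<Rightarrow> (nat \<Rightarrow> 'a \<times> 'xi) \<Rightarrow> 'xi measure) \<Rightarrow> bool" where
  "adversary_strategy X \<Xi> \<D> \<longleftrightarrow> (\<forall>t. \<D> t \<in> history X \<Xi> t \<rightarrow>\<^sub>M prob_algebra \<Xi>)"

text \<open>
  The joint law of \<open>T\<close> rounds. Given the history, \<open>x\<^sub>t\<close> and \<open>\<xi>\<^sub>t\<close> are drawn independently,
  since neither player sees the other's choice for the current round.
\<close>

definition play_law ::
  "'a::euclidean_space set \<Rightarrow> 'xi measure \<Rightarrow> (nat \<Rightarrow> (nat \<Rightarrow> 'a \<times> 'xi) \<Rightarrow> 'a measure) \<Rightarrow>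
   (nat \<Rightarrow> (nat \<Rightarrow> 'a \<times> 'xi) \<Rightarrow> 'xi measure) \<Rightarrow> nat \<Rightarrow> (nat \<Rightarrow> 'a \<times> 'xi) measure" where
  "play_law X \<Xi> \<A> \<D> T =
     Ionescu_Tulcea.C (\<lambda>t \<omega>. \<A> t \<omega> \<Otimes>\<^sub>M \<D> t \<omega>) (\<lambda>_. round_space X \<Xi>) 0 T (\<lambda>_. undefined)"

lemma Ionescu_Tulcea_play:
  assumes "learner_strategy X \<Xi> \<A>" "adversary_strategy X \<Xi> \<D>"
  shows "Ionescu_Tulcea (\<lambda>t \<omega>. \<A> t \<omega> \<Otimes>\<^sub>M \<D> t \<omega>) (\<lambda>_. round_space X \<Xi>)"
proof -
  have K: "(\<lambda>\<omega>. \<A> t \<omega> \<Otimes>\<^sub>M \<D> t \<omega>) \<in>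
      (\<Pi>\<^sub>M i\<in>{0..<t}. round_space X \<Xi>) \<rightarrow>\<^sub>M prob_algebra (round_space X \<Xi>)" for t
    using assms unfolding learner_strategy_def adversary_strategy_def history_def round_space_def
    by (intro measurable_pair_prob) auto
  show ?thesis
  proof (rule Ionescu_Tulcea.intro)
    show "(\<lambda>\<omega>. \<A> t \<omega> \<Otimes>\<^sub>M \<D> t \<omega>) \<in>
        (\<Pi>\<^sub>M i\<in>{0..<t}. round_space X \<Xi>) \<rightarrow>\<^sub>M subprob_algebra (round_space X \<Xi>)" for t
      using K by (rule measurable_prob_algebraD)
    show "prob_space (\<A> t \<omega> \<Otimes>\<^sub>M \<D> t \<omega>)"
      if "\<omega> \<in> space (\<Pi>\<^sub>M i\<in>{0..<t}. round_space X \<Xi>)" for t \<omega>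
      using measurable_space[OF K that] by (simp add: space_prob_algebra)
  qed
qed

text \<open>The distribution \<open>\<D>\<^sub>t\<close> that is used in round \<open>t\<close> of the play \<open>\<omega>\<close>.\<close>

definition dist_at ::
  "(nat \<Rightarrow> (nat \<Rightarrow> 'a \<times> 'xi) \<Rightarrow> 'xi measure) \<Rightarrow> nat \<Rightarrow> (nat \<Rightarrow> 'a \<times> 'xi) \<Rightarrow> 'xi measure" where
  "dist_at \<D> t \<omega> = \<D> t (restrict \<omega> {0..<t})"

definition sigma_bar ::
  "'a::euclidean_space set \<Rightarrow> 'xi measure \<Rightarrow> ('a \<Rightarrow> 'xi \<Rightarrow> real) \<Rightarrow>
   (nat \<Rightarrow> (nat \<Rightarrow> 'a \<times> 'xi) \<Rightarrow> 'a measure) \<Rightarrow>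
   (nat \<Rightarrow> (nat \<Rightarrow> 'a \<times> 'xi) \<Rightarrow> 'xi measure) \<Rightarrow> nat \<Rightarrow> real" where
  "sigma_bar X \<Xi> f \<A> \<D> T =
     sqrt (1 / real T *
       (\<integral>\<omega>. (\<Sum>t<T. grad_variance X f (dist_at \<D> t \<omega>)) \<partial>play_law X \<Xi> \<A> \<D> T))"

text \<open>
  In the first round \<open>t = 0\<close> truncated subtraction gives \<open>t - 1 = 0\<close>, which is the convention
  that the mean loss preceding the first one equals the first one.
\<close>

definition Sigma_bar ::
  "'a::euclidean_space set \<Rightarrow> 'xi measure \<Rightarrow> ('a \<Rightarrow> 'xi \<Rightarrow> real) \<Rightarrow>
   (nat \<Rightarrow> (nat \<Rightarrow> 'a \<times> 'xi) \<Rightarrow> 'a measure) \<Rightarrow>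
   (nat \<Rightarrow> (nat \<Rightarrow> 'a \<times> 'xi) \<Rightarrow> 'xi measure) \<Rightarrow> nat \<Rightarrow> real" where
  "Sigma_bar X \<Xi> f \<A> \<D> T =
     sqrt (1 / real T *
       (\<integral>\<omega>. (\<Sum>t<T. SUP x\<in>X.
           (norm (mean_grad f (dist_at \<D> t \<omega>) x - mean_grad f (dist_at \<D> (t - 1) \<omega>) x))\<^sup>2)
         \<partial>play_law X \<Xi> \<A> \<D> T))"

definition regret ::
  "('a::euclidean_space \<Rightarrow> 'xi \<Rightarrow> real) \<Rightarrow> nat \<Rightarrow> 'a \<Rightarrow> (nat \<Rightarrow> 'a \<times> 'xi) \<Rightarrow> real" where
  "regret f T u \<omega> = (\<Sum>t<T. grad f (fst (\<omega> t)) (snd (\<omega> t)) \<bullet> (fst (\<omega> t) - u))"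

definition expected_regret ::
  "'a::euclidean_space set \<Rightarrow> 'xi measure \<Rightarrow> ('a \<Rightarrow> 'xi \<Rightarrow> real) \<Rightarrow>
   (nat \<Rightarrow> (nat \<Rightarrow> 'a \<times> 'xi) \<Rightarrow> 'a measure) \<Rightarrow>
   (nat \<Rightarrow> (nat \<Rightarrow> 'a \<times> 'xi) \<Rightarrow> 'xi measure) \<Rightarrow> nat \<Rightarrow> 'a \<Rightarrow> real" where
  "expected_regret X \<Xi> f \<A> \<D> T u = (\<integral>\<omega>. regret f T u \<omega> \<partial>play_law X \<Xi> \<A> \<D> T)"

text \<open>
  The universal constant. The dimension of the ambient space is a type, so an existential
  quantifier inside the theorem could only give a constant depending on the dimension; a closed
  real number is uniform in all dimensions.
\<close>

definition regret_constant :: real where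
  "regret_constant = 1 / 100"

end

theory Submission
  imports Defs
begin

text \<open>
  The losses are linear along a direction \<open>e\<close> joining two points of \<open>X\<close> at distance
  \<open>diameter X\<close>, with slope \<open>\<xi>\<close>. In every round \<open>\<xi>\<close> is uniform on \<open>{\<mu>\<^sub>t - M, \<mu>\<^sub>t + M}\<close>, where
  \<open>\<mu>\<^sub>t = 0\<close> for even \<open>t\<close> and \<open>\<mu>\<^sub>t = \<plusminus>M\<close> for odd \<open>t\<close>. Whatever the signs are, the variance is \<open>M\<^sup>2\<close>
  and the mean gradient moves by \<open>M\<close> in each round, so both averages are of order \<open>M\<close>.

  The signs are deterministic but adapted to the learner. The mean action \<open>m\<^sub>k\<close> in the
  \<open>k\<close>-th odd round depends only on the earlier signs; were the signs fair coins, the terms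
  \<open>s\<^sub>k m\<^sub>k\<close> would average out, and the better of the two endpoints would still gain half the
  diameter times \<open>\<bar>\<Sum> s\<^sub>k\<bar>\<close>, which is of order \<open>sqrt T\<close>. A greedy choice of the signs does at
  least as well as the average over the coins.
\<close>

section \<open>Signs chosen against a predictable sequence\<close>

text \<open>For a fair coin \<open>s k\<close>, the predictable term \<open>s k * m s k\<close> has
  mean zero and \<open>h\<close> does not decrease on average. So in each step one of the two signs
  keeps the accumulated sum plus \<open>h\<close> at or above its previous value.\<close>

lemma signs_against_supermartingale:
  fixes m :: "(nat \<Rightarrow> real) \<Rightarrow> nat \<Rightarrow> real" and h :: "nat \<Rightarrow> real \<Rightarrow> real"
  assumes causal: "\<And>s s' k. (\<forall>i<k. s i = s' i) \<Longrightarrow> m s k = m s' k"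
    and h: "\<And>k S. 2 * h k S \<le> h (Suc k) (S + 1) + h (Suc k) (S - 1)"
  shows "\<exists>s. (\<forall>k. s k \<in> {-1, 1}) \<and> h 0 0 \<le> (\<Sum>k<n. s k * m s k) + h n (\<Sum>k<n. s k)"
proof (induction n)
  case 0
  show ?case by (auto intro!: exI[of _ "\<lambda>_. 1"])
next
  case (Suc n)
  then obtain s where s: "\<And>k. s k \<in> {-1, 1}"
    and le: "h 0 0 \<le> (\<Sum>k<n. s k * m s k) + h n (\<Sum>k<n. s k)"
    by blast
  define S where "S = (\<Sum>k<n. s k)"
  obtain \<epsilon> :: real where \<epsilon>: "\<epsilon> \<in> {-1, 1}" and better: "h n S \<le> \<epsilon> * m s n + h (Suc n) (S + \<epsilon>)"
  proof (cases "h n S \<le> m s n + h (Suc n) (S + 1)")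
    case True
    then show ?thesis using that[of 1] by simp
  next
    case False
    then show ?thesis using that[of "-1"] h[of n S] by simp
  qed
  define s' where "s' = s(n := \<epsilon>)"
  \<comment> \<open>Even the term at index \<open>n\<close> sees only signs before \<open>n\<close>,
    so the update disturbs nothing already accumulated.\<close>
  have "m s' k = m s k" if "k \<le> n" for k
    using that by (intro causal) (auto simp: s'_def)
  then have "(\<Sum>k<Suc n. s' k * m s' k) = (\<Sum>k<n. s k * m s k) + \<epsilon> * m s n"
    by (simp add: s'_def)
  moreover have "(\<Sum>k<Suc n. s' k) = S + \<epsilon>"
    by (simp add: s'_def S_def)
  moreover have "\<forall>k. s' k \<in> {-1, 1}"
    using s \<epsilon> by (simp add: s'_def)
  ultimately show ?case
    using le better by (intro exI[of _ s']) (auto simp: S_def)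
qed

text \<open>
  A polynomial minorant of \<open>\<bar>S\<bar>\<close>, so that only the second and fourth moments of a
  random walk are needed to bound its expected absolute value; the two sides touch at \<open>\<bar>S\<bar> = 2 K\<close>.
\<close>

lemma abs_ge_quartic:
  fixes K S :: real
  assumes "K \<ge> 0"
  shows "12 * K\<^sup>2 * S\<^sup>2 - S ^ 4 \<le> 16 * K ^ 3 * \<bar>S\<bar>"
proof -
  have "0 \<le> \<bar>S\<bar> * ((\<bar>S\<bar> - 2 * K)\<^sup>2 * (\<bar>S\<bar> + 4 * K))"
    using assms by simp
  also have "\<dots> = \<bar>S\<bar> ^ 4 - 12 * K\<^sup>2 * \<bar>S\<bar>\<^sup>2 + 16 * K ^ 3 * \<bar>S\<bar>"
    by (simp add: algebra_simps power2_eq_square power3_eq_cube power4_eq_xxxx)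
  finally show ?thesis by simp
qed

text \<open>A simple random walk of \<open>n\<close> steps has second moment \<open>n\<close> and
  fourth moment \<open>3 n^2 - 2 n\<close>, so the quartic minorant has mean at least
  \<open>9 n^2\<close>; division by \<open>16 * K ^ 3\<close> yields the factor
  \<open>9 / 16\<close>.\<close>

lemma signs_with_large_sum:
  fixes m :: "(nat \<Rightarrow> real) \<Rightarrow> nat \<Rightarrow> real" and c :: real
  assumes causal: "\<And>s s' k. (\<forall>i<k. s i = s' i) \<Longrightarrow> m s k = m s' k" and "c \<ge> 0"
  shows "\<exists>s. (\<forall>k. s k \<in> {-1, 1}) \<and>
    9 / 16 * c * sqrt (real n) \<le> (\<Sum>k<n. s k * m s k) + c * \<bar>\<Sum>k<n. s k\<bar>"
proof (cases "n = 0")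
  case True
  then show ?thesis by (auto intro!: exI[of _ "\<lambda>_. 1"])
next
  case False
  define K where "K = sqrt (real n)"
  have K: "K > 0" "K\<^sup>2 = real n"
    using False by (auto simp: K_def)
  define \<Phi> :: "nat \<Rightarrow> real \<Rightarrow> real" where
    "\<Phi> k S = (let r = K\<^sup>2 - real k in 12 * K\<^sup>2 * (S\<^sup>2 + r) - (S ^ 4 + 6 * S\<^sup>2 * r + 3 * r\<^sup>2 - 2 * r))" for k S
  \<comment> \<open>The expectation of \<open>12 K\<^sup>2 Z\<^sup>2 - Z\<^sup>4\<close> for a simple random walk \<open>Z\<close> with
    \<open>n - k\<close> steps to go from \<open>S\<close>, hence a martingale.\<close>
  define a where "a = c / (16 * K ^ 3)"
  have a: "a \<ge> 0" "a * (16 * K ^ 3) = c"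
    using K \<open>c \<ge> 0\<close> by (auto simp: a_def)
  \<comment> \<open>\<open>r\<close> is a real number and may become negative, so this polynomial
    identity also holds for \<open>k\<close> beyond \<open>n\<close>.\<close>
  have "2 * \<Phi> k S = \<Phi> (Suc k) (S + 1) + \<Phi> (Suc k) (S - 1)" for k S
    unfolding \<Phi>_def Let_def by (simp add: algebra_simps power2_eq_square power4_eq_xxxx)
  then have "2 * (a * \<Phi> k S) \<le> a * \<Phi> (Suc k) (S + 1) + a * \<Phi> (Suc k) (S - 1)" for k S
    by (metis distrib_left mult.left_commute order_refl)
  from signs_against_supermartingale[of m "\<lambda>k S. a * \<Phi> k S", OF causal this]
  obtain s where s: "\<forall>k. s k \<in> {-1, 1}"
    and le: "a * \<Phi> 0 0 \<le> (\<Sum>k<n. s k * m s k) + a * \<Phi> n (\<Sum>k<n. s k)"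
    by blast
  \<comment> \<open>At time \<open>n\<close> the remainder \<open>r\<close> vanishes and \<Phi> is
    the minorant itself.\<close>
  have "a * \<Phi> n S \<le> c * \<bar>S\<bar>" for S
  proof -
    have "\<Phi> n S \<le> 16 * K ^ 3 * \<bar>S\<bar>"
      using abs_ge_quartic[of K S] K by (simp add: \<Phi>_def)
    from mult_left_mono[OF this a(1)] a(2) show ?thesis
      by (metis mult.assoc)
  qed
  moreover have "9 / 16 * c * K \<le> a * \<Phi> 0 0"
  proof -
    have "\<Phi> 0 0 = 9 * K ^ 4 + 2 * K\<^sup>2"
      by (simp add: \<Phi>_def algebra_simps power2_eq_square power4_eq_xxxx)
    then have "9 * K ^ 4 \<le> \<Phi> 0 0" by simp
    from mult_left_mono[OF this a(1)] show ?thesis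
      unfolding a(2)[symmetric] by (simp add: power4_eq_xxxx power3_eq_cube ac_simps)
  qed
  ultimately show ?thesis
    using s le unfolding K_def by (intro exI[of _ s]) (smt (verit))
qed

lemma sum_odd_rounds:
  fixes g :: "nat \<Rightarrow> real"
  shows "(\<Sum>t<T. if odd t then g (t div 2) else 0) = (\<Sum>k<T div 2. g k)"
  by (induction T) (auto elim!: oddE evenE)

section \<open>Linear losses with two-point slopes\<close>

text \<open>
  The distributions used below never leave \<open>{- B..B}\<close>; clamping makes the gradient bounded on the
  whole sample space.
\<close>

definition clamp :: "real \<Rightarrow> real \<Rightarrow> real" where
  "clamp B \<xi> = max (- B) (min B \<xi>)"

definition linear_loss :: "real \<Rightarrow> 'a::euclidean_space \<Rightarrow> 'a \<Rightarrow> real \<Rightarrow> real" where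
  "linear_loss B e x \<xi> = clamp B \<xi> * (e \<bullet> x)"

definition two_point :: "real \<Rightarrow> real \<Rightarrow> real measure" where
  "two_point M \<mu> = measure_pmf (map_pmf (\<lambda>b. if b then \<mu> + M else \<mu> - M) (bernoulli_pmf (1 / 2)))"

lemma abs_clamp_le: "B \<ge> 0 \<Longrightarrow> \<bar>clamp B \<xi>\<bar> \<le> B"
  by (auto simp: clamp_def)

lemma clamp_eq: "\<bar>\<xi>\<bar> \<le> B \<Longrightarrow> clamp B \<xi> = \<xi>"
  by (auto simp: clamp_def)

lemma GDERIV_linear_loss: "GDERIV (\<lambda>y. linear_loss B e y \<xi>) x :> clamp B \<xi> *\<^sub>R e"
  unfolding gderiv_def linear_loss_def
  by (auto intro!: derivative_eq_intros simp: inner_commute)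

lemma grad_linear_loss: "grad (linear_loss B e) x \<xi> = clamp B \<xi> *\<^sub>R e"
  unfolding grad_def
proof (rule the_equality)
  fix v assume "GDERIV (\<lambda>y. linear_loss B e y \<xi>) x :> v"
  then have "(\<lambda>h. h \<bullet> v) = (\<lambda>h. h \<bullet> (clamp B \<xi> *\<^sub>R e))"
    using GDERIV_linear_loss[of B e \<xi> x] unfolding gderiv_def by (rule has_derivative_unique)
  then show "v = clamp B \<xi> *\<^sub>R e"
    by (metis inner_commute vector_eq_rdot)
qed (rule GDERIV_linear_loss)

lemma sets_two_point [measurable_cong]: "sets (two_point M \<mu>) = sets (count_space UNIV)"
  by (simp add: two_point_def)

lemma prob_space_two_point: "prob_space (two_point M \<mu>)"
  by (simp add: two_point_def measure_pmf.prob_space_axioms)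

lemma integrable_two_point: "integrable (two_point M \<mu>) (g :: real \<Rightarrow> 'b::{banach, second_countable_topology})"
  unfolding two_point_def by (intro integrable_measure_pmf_finite) simp

lemma integral_two_point:
  "(\<integral>\<xi>. g \<xi> \<partial>two_point M \<mu>) = (g (\<mu> + M) + g (\<mu> - M)) / (2 :: real)"
  by (simp add: two_point_def)

text \<open>Both atoms lie within \<open>2 * M\<close> of zero, where clamping changes
  nothing.\<close>

lemma integral_clamp_two_point:
  assumes "\<bar>\<mu>\<bar> \<le> M"
  shows "(\<integral>\<xi>. clamp (2 * M) \<xi> \<partial>two_point M \<mu>) = \<mu>"
  using assms by (simp add: integral_two_point clamp_eq)

lemma mean_grad_two_point:
  assumes "\<bar>\<mu>\<bar> \<le> M"
  shows "mean_grad (linear_loss (2 * M) e) (two_point M \<mu>) x = \<mu> *\<^sub>R e"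
  unfolding mean_grad_def grad_linear_loss
  by (simp add: integrable_two_point integral_clamp_two_point[OF assms])

text \<open>Both slopes are at distance \<open>M\<close> from their mean whatever \<mu> is, so
  adapting the signs cannot affect the variance.\<close>

lemma variance_two_point:
  assumes "\<bar>\<mu>\<bar> \<le> M" "norm e = 1"
  shows "(\<integral>\<xi>. (norm (grad (linear_loss (2 * M) e) x \<xi> -
      mean_grad (linear_loss (2 * M) e) (two_point M \<mu>) x))\<^sup>2 \<partial>two_point M \<mu>) = M\<^sup>2"
  using assms
  by (simp add: mean_grad_two_point grad_linear_loss integral_two_point clamp_eq
      flip: scaleR_left_diff_distrib)

text \<open>A linear loss is convex for slopes of either sign, and its mean gradient is the same at
  every point, which gives the Lipschitz constant \<open>0\<close>.\<close>

lemma admissible_two_point: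
  assumes "\<bar>\<mu>\<bar> \<le> M" "norm e = 1" "convex X"
  shows "admissible X (linear_loss (2 * M) e) (2 * M) 0 (two_point M \<mu>)"
proof -
  have "M \<ge> 0" using assms(1) by simp
  have "convex_on X (\<lambda>x. linear_loss (2 * M) e x \<xi>)" for \<xi>
    unfolding linear_loss_def convex_on_def using assms(3)
    by (auto simp: inner_add_right algebra_simps)
  moreover have "norm (grad (linear_loss (2 * M) e) x \<xi>) \<le> 2 * M" for x \<xi>
    using assms(2) abs_clamp_le[of "2 * M" \<xi>] \<open>M \<ge> 0\<close> by (simp add: grad_linear_loss)
  moreover have "0-lipschitz_on X (mean_grad (linear_loss (2 * M) e) (two_point M \<mu>))"
    using assms(1) by (auto simp: lipschitz_on_def mean_grad_two_point)
  ultimately show ?thesis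
    by (auto simp: admissible_def integrable_two_point)
qed

section \<open>The law of a play, round by round\<close>

text \<open>Later kernels do not alter the law of earlier coordinates, so the play may be cut after
  round \<open>t\<close>. The last kernel is then split off as a bind, and the bound
  \<open>B\<close> lets the integral pass through it.\<close>

lemma (in Ionescu_Tulcea) integral_C_component:
  fixes F :: "'a \<Rightarrow> real"
  assumes "t < T" and F [measurable]: "F \<in> borel_measurable (M t)"
    and B: "\<And>z. z \<in> space (M t) \<Longrightarrow> \<bar>F z\<bar> \<le> B"
  shows "(\<integral>\<omega>. F (\<omega> t) \<partial>C 0 T (\<lambda>_. undefined)) = (\<integral>\<omega>. (\<integral>z. F z \<partial>P t \<omega>) \<partial>C 0 t (\<lambda>_. undefined))"
proof -
  let ?u = "\<lambda>_. undefined :: 'a"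
  have u: "?u \<in> space (PiM {0..<0} M)"
    by (simp add: space_PiM)
  have F' [measurable]: "(\<lambda>\<omega>. F (\<omega> t)) \<in> borel_measurable (PiM {0..<Suc t} M)"
    by measurable
  have "(\<integral>\<omega>. F (\<omega> t) \<partial>C 0 (Suc t) ?u) =
      (\<integral>\<omega>. F (\<omega> t) \<partial>distr (C 0 T ?u) (PiM {0..<0 + Suc t} M) (\<lambda>x. restrict x {0..<0 + Suc t}))"
    using \<open>t < T\<close> u by (subst distr_C[of "Suc t" T]) auto
  also have "\<dots> = (\<integral>\<omega>. F (restrict \<omega> {0..<0 + Suc t} t) \<partial>C 0 T ?u)"
  proof (rule integral_distr)
    show "(\<lambda>x. restrict x {0..<0 + Suc t}) \<in> C 0 T ?u \<rightarrow>\<^sub>M PiM {0..<0 + Suc t} M"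
      unfolding measurable_cong_sets[OF sets_C[OF u] refl]
      using \<open>t < T\<close> by (intro measurable_restrict_subset) auto
  qed simp
  finally have "(\<integral>\<omega>. F (\<omega> t) \<partial>C 0 T ?u) = (\<integral>\<omega>. F (\<omega> t) \<partial>C 0 (Suc t) ?u)"
    by simp
  also have "\<dots> = (\<integral>\<omega>. (\<integral>\<omega>'. F (\<omega>' t) \<partial>eP t \<omega>) \<partial>C 0 t ?u)"
  proof -
    interpret C: prob_space "C 0 t ?u" by (rule prob_space_C[OF u])
    show ?thesis
      unfolding C.simps add_0
    proof (rule integral_bind[where K = "PiM {0..<Suc t} M" and B = B and B' = 1])
      show "eP t \<in> C 0 t ?u \<rightarrow>\<^sub>M subprob_algebra (PiM {0..<Suc t} M)"
        unfolding measurable_cong_sets[OF sets_C[OF u] refl] by simp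
      show "AE \<omega> in C 0 t ?u. emeasure (eP t \<omega>) (space (eP t \<omega>)) \<le> ennreal 1"
        using u by (auto simp: space_C prob_space.emeasure_space_1[OF prob_space_eP])
      show "\<bar>F (\<omega> t)\<bar> \<le> B" if "\<omega> \<in> space (PiM {0..<Suc t} M)" for \<omega>
        using that by (intro B) (auto simp: space_PiM PiE_iff)
    qed (use C.finite_measure_axioms in auto)
  qed
  also have "\<dots> = (\<integral>\<omega>. (\<integral>z. F z \<partial>P t \<omega>) \<partial>C 0 t ?u)"
  proof (rule Bochner_Integration.integral_cong[OF refl])
    fix \<omega> assume "\<omega> \<in> space (C 0 t ?u)"
    then have \<omega>: "\<omega> \<in> space (PiM {0..<t} M)"
      using space_C[OF u] by simp
    \<comment> \<open>\<open>eP t \<omega>\<close> is the image of \<open>P t \<omega>\<close> under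
      this update, so its coordinate \<open>t\<close> has law \<open>P t \<omega>\<close>.\<close>
    have "fun_upd \<omega> t \<in> P t \<omega> \<rightarrow>\<^sub>M PiM {0..<Suc t} M"
      unfolding measurable_cong_sets[OF sets_P[OF \<omega>] refl]
      using \<omega> by (intro measurable_fun_upd[where J = "{0..<t}"]) auto
    then show "(\<integral>\<omega>'. F (\<omega>' t) \<partial>eP t \<omega>) = (\<integral>z. F z \<partial>P t \<omega>)"
      unfolding eP_def by (subst integral_distr) auto
  qed
  finally show ?thesis .
qed

lemma play_law_prob_space:
  assumes "learner_strategy X \<Xi> \<A>" "adversary_strategy X \<Xi> \<D>"
  shows "prob_space (play_law X \<Xi> \<A> \<D> T)"
  unfolding play_law_def
  by (rule Ionescu_Tulcea.prob_space_C[OF Ionescu_Tulcea_play[OF assms]]) (simp add: space_PiM)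

lemma sets_play_law:
  assumes "learner_strategy X \<Xi> \<A>" "adversary_strategy X \<Xi> \<D>"
  shows "sets (play_law X \<Xi> \<A> \<D> t) = sets (history X \<Xi> t)"
  unfolding play_law_def history_def
  by (subst Ionescu_Tulcea.sets_C[OF Ionescu_Tulcea_play[OF assms]]) (simp_all add: space_PiM)

lemmas space_play_law = sets_play_law[THEN sets_eq_imp_space_eq]

text \<open>This is the source of predictability: the mean action in a round cannot react to signs
  used in that round or later.\<close>

lemma play_law_cong:
  assumes "learner_strategy X \<Xi> \<A>" "adversary_strategy X \<Xi> \<D>" "adversary_strategy X \<Xi> \<D>'"
    and "\<And>i. i < t \<Longrightarrow> \<D> i = \<D>' i"
  shows "play_law X \<Xi> \<A> \<D> t = play_law X \<Xi> \<A> \<D>' t"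
  using assms(4)
proof (induction t)
  case 0
  show ?case
    unfolding play_law_def by (simp add: Ionescu_Tulcea.C.simps[OF Ionescu_Tulcea_play] assms)
next
  case (Suc t)
  note I = Ionescu_Tulcea_play[OF assms(1,2)] Ionescu_Tulcea_play[OF assms(1,3)]
  have "\<D> t = \<D>' t" by (simp add: Suc.prems)
  then show ?case
    using Suc unfolding play_law_def
    by (simp add: I[THEN Ionescu_Tulcea.C.simps(2)] I[THEN Ionescu_Tulcea.eP_def, abs_def])
qed

section \<open>Expected regret in terms of mean actions\<close>

text \<open>Integrating over the first \<open>t\<close> rounds only, instead of the whole play,
  makes the dependence on earlier kernels alone visible.\<close>

definition mean_action ::
  "'a::euclidean_space set \<Rightarrow> 'xi measure \<Rightarrow> (nat \<Rightarrow> (nat \<Rightarrow> 'a \<times> 'xi) \<Rightarrow> 'a measure) \<Rightarrow>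
   (nat \<Rightarrow> (nat \<Rightarrow> 'a \<times> 'xi) \<Rightarrow> 'xi measure) \<Rightarrow> 'a \<Rightarrow> nat \<Rightarrow> real" where
  "mean_action X \<Xi> \<A> \<D> e t = (\<integral>\<omega>. (\<integral>x. e \<bullet> x \<partial>\<A> t \<omega>) \<partial>play_law X \<Xi> \<A> \<D> t)"

lemma adversary_two_point:
  "adversary_strategy X (count_space UNIV) (\<lambda>t _. two_point M (\<mu> t))"
  unfolding adversary_strategy_def
  by (auto simp: space_prob_algebra prob_space_two_point sets_two_point intro!: measurable_const)

text \<open>Given the history, slope and action are independent, so the slope may be replaced by its
  mean; by linearity only the mean action along \<open>e\<close> survives.\<close>

lemma expected_regret_two_point:
  fixes X :: "'a::euclidean_space set" and M :: real and \<mu> :: "nat \<Rightarrow> real"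
  defines "\<Xi> \<equiv> count_space UNIV" and "\<D> \<equiv> \<lambda>t _. two_point M (\<mu> t)"
  assumes \<A>: "learner_strategy X \<Xi> \<A>"
    and "bounded X" and \<mu>: "\<And>t. \<bar>\<mu> t\<bar> \<le> M"
  shows "expected_regret X \<Xi> (linear_loss (2 * M) e) \<A> \<D> T u =
    (\<Sum>t<T. \<mu> t * (mean_action X \<Xi> \<A> \<D> e t - e \<bullet> u))"
proof -
  let ?R = "restrict_space borel X"
  have \<D>: "adversary_strategy X \<Xi> \<D>"
    unfolding \<Xi>_def \<D>_def by (rule adversary_two_point)
  interpret IT: Ionescu_Tulcea "\<lambda>t \<omega>. \<A> t \<omega> \<Otimes>\<^sub>M \<D> t \<omega>" "\<lambda>_. round_space X \<Xi>"
    by (rule Ionescu_Tulcea_play[OF \<A> \<D>])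
  have M: "M \<ge> 0" using \<mu>[of 0] by simp
  obtain b where b: "\<And>x. x \<in> X \<Longrightarrow> norm x \<le> b"
    using \<open>bounded X\<close> by (auto simp: bounded_iff)
  define B where "B = 2 * M * (norm e * (b + norm u))"
  define F where "F = (\<lambda>z::'a \<times> real. clamp (2 * M) (snd z) * (e \<bullet> (fst z - u)))"
  have F_meas [measurable]: "F \<in> borel_measurable (round_space X \<Xi>)"
    unfolding F_def round_space_def \<Xi>_def
    by (intro borel_measurable_times borel_measurable_inner borel_measurable_diff
        measurable_compose[OF measurable_snd] measurable_compose[OF measurable_fst])
       (auto intro!: measurable_restrict_space1)
  have F_le: "\<bar>F z\<bar> \<le> B" if "z \<in> space (round_space X \<Xi>)" for z
  proof -
    have "fst z \<in> X"
      using that by (auto simp: round_space_def space_pair_measure space_restrict_space)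
    have "\<bar>e \<bullet> (fst z - u)\<bar> \<le> norm e * norm (fst z - u)"
      by (rule Cauchy_Schwarz_ineq2)
    also have "\<dots> \<le> norm e * (b + norm u)"
      using b[OF \<open>fst z \<in> X\<close>] norm_triangle_ineq4[of "fst z" u] by (intro mult_left_mono) auto
    finally show ?thesis
      unfolding F_def B_def abs_mult using M by (intro mult_mono abs_clamp_le) auto
  qed
  have P: "prob_space (play_law X \<Xi> \<A> \<D> t)" for t
    by (rule play_law_prob_space[OF \<A> \<D>])
  have round: "(\<integral>\<omega>. F (\<omega> t) \<partial>play_law X \<Xi> \<A> \<D> T) = \<mu> t * (mean_action X \<Xi> \<A> \<D> e t - e \<bullet> u)"
    if "t < T" for t
  proof -
    interpret P: prob_space "play_law X \<Xi> \<A> \<D> t" by (rule P)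
    have \<A>_space: "\<A> t \<omega> \<in> space (prob_algebra ?R)"
      if "\<omega> \<in> space (play_law X \<Xi> \<A> \<D> t)" for \<omega>
      using \<A> that unfolding learner_strategy_def space_play_law[OF \<A> \<D>]
      by (intro measurable_space[of "\<A> t"]) auto
    \<comment> \<open>The last bound is uniform in \<omega>; it makes the conditional means
      integrable over the histories.\<close>
    have \<A>_int: "integrable (\<A> t \<omega>) (\<lambda>x. e \<bullet> x)" "prob_space (\<A> t \<omega>)"
      "\<bar>\<integral>x. e \<bullet> x \<partial>\<A> t \<omega>\<bar> \<le> norm e * b"
      if \<omega>: "\<omega> \<in> space (play_law X \<Xi> \<A> \<D> t)" for \<omega>
    proof -
      show "prob_space (\<A> t \<omega>)"
        using \<A>_space[OF \<omega>] by (simp add: space_prob_algebra)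
      interpret A: prob_space "\<A> t \<omega>" by fact
      have s: "sets (\<A> t \<omega>) = sets ?R"
        using \<A>_space[OF \<omega>] by (simp add: space_prob_algebra)
      have le: "AE x in \<A> t \<omega>. norm (e \<bullet> x) \<le> norm e * b"
      proof (rule AE_I2)
        fix x assume "x \<in> space (\<A> t \<omega>)"
        then have "x \<in> X"
          using sets_eq_imp_space_eq[OF s] by (simp add: space_restrict_space)
        then show "norm (e \<bullet> x) \<le> norm e * b"
          using Cauchy_Schwarz_ineq2[of e x] mult_left_mono[OF b, of x "norm e"] by simp
      qed
      then show "integrable (\<A> t \<omega>) (\<lambda>x. e \<bullet> x)"
        by (rule A.integrable_const_bound)
           (subst measurable_cong_sets[OF s refl], auto intro!: measurable_restrict_space1)
      moreover from le have "AE x in \<A> t \<omega>. e \<bullet> x \<le> norm e * b"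
        by (rule eventually_mono) simp
      moreover from le have "AE x in \<A> t \<omega>. - (norm e * b) \<le> e \<bullet> x"
        by (rule eventually_mono) (simp add: abs_le_iff)
      ultimately show "\<bar>\<integral>x. e \<bullet> x \<partial>\<A> t \<omega>\<bar> \<le> norm e * b"
        by (simp add: abs_le_iff minus_le_iff A.integral_le_const A.integral_ge_const)
    qed
    have inner: "(\<integral>z. F z \<partial>(\<A> t \<omega> \<Otimes>\<^sub>M \<D> t \<omega>)) = \<mu> t * ((\<integral>x. e \<bullet> x \<partial>\<A> t \<omega>) - e \<bullet> u)"
      if \<omega>: "\<omega> \<in> space (play_law X \<Xi> \<A> \<D> t)" for \<omega>
    proof -
      interpret A: prob_space "\<A> t \<omega>" by (rule \<A>_int(2)[OF \<omega>])
      interpret D: prob_space "\<D> t \<omega>" by (simp add: \<D>_def prob_space_two_point)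
      interpret AD: pair_prob_space "\<A> t \<omega>" "\<D> t \<omega>" ..
      have s: "sets (\<A> t \<omega> \<Otimes>\<^sub>M \<D> t \<omega>) = sets (round_space X \<Xi>)"
        using \<A>_space[OF \<omega>]
        by (auto simp: round_space_def \<D>_def \<Xi>_def sets_two_point space_prob_algebra intro!: sets_pair_measure_cong)
      have "integrable (\<A> t \<omega> \<Otimes>\<^sub>M \<D> t \<omega>) F"
        using F_le F_meas measurable_cong_sets[OF s refl, of borel] sets_eq_imp_space_eq[OF s]
        by (intro AD.P.integrable_const_bound[of _ B] AE_I2) auto
      then have "(\<integral>z. F z \<partial>(\<A> t \<omega> \<Otimes>\<^sub>M \<D> t \<omega>)) = (\<integral>x. (\<integral>\<xi>. F (x, \<xi>) \<partial>\<D> t \<omega>) \<partial>\<A> t \<omega>)"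
        by (rule AD.integral_fst'[symmetric])
      also have "\<dots> = (\<integral>x. \<mu> t * (e \<bullet> x - e \<bullet> u) \<partial>\<A> t \<omega>)"
        by (simp add: F_def \<D>_def integral_clamp_two_point[OF \<mu>] inner_diff_right)
      also have "\<dots> = \<mu> t * ((\<integral>x. e \<bullet> x \<partial>\<A> t \<omega>) - e \<bullet> u)"
        using \<A>_int(1)[OF \<omega>] by (simp add: A.prob_space)
      finally show ?thesis .
    qed
    have int: "integrable (play_law X \<Xi> \<A> \<D> t) (\<lambda>\<omega>. \<integral>x. e \<bullet> x \<partial>\<A> t \<omega>)"
    proof (rule P.integrable_const_bound[of _ "norm e * b"])
      show "AE \<omega> in play_law X \<Xi> \<A> \<D> t. norm (\<integral>x. e \<bullet> x \<partial>\<A> t \<omega>) \<le> norm e * b"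
        using \<A>_int(3) by (intro AE_I2) simp
      have "\<A> t \<in> history X \<Xi> t \<rightarrow>\<^sub>M subprob_algebra ?R"
        using \<A> by (simp add: learner_strategy_def measurable_prob_algebraD)
      then have "\<A> t \<in> play_law X \<Xi> \<A> \<D> t \<rightarrow>\<^sub>M subprob_algebra ?R"
        by (simp add: measurable_cong_sets[OF sets_play_law[OF \<A> \<D>] refl])
      then show "(\<lambda>\<omega>. \<integral>x. e \<bullet> x \<partial>\<A> t \<omega>) \<in> borel_measurable (play_law X \<Xi> \<A> \<D> t)"
        by (rule measurable_compose[OF _ integral_measurable_subprob_algebra])
           (auto intro!: measurable_restrict_space1)
    qed
    have "(\<integral>\<omega>. F (\<omega> t) \<partial>play_law X \<Xi> \<A> \<D> T) =
        (\<integral>\<omega>. (\<integral>z. F z \<partial>(\<A> t \<omega> \<Otimes>\<^sub>M \<D> t \<omega>)) \<partial>play_law X \<Xi> \<A> \<D> t)"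
      unfolding play_law_def by (rule IT.integral_C_component[OF that F_meas F_le])
    also have "\<dots> = (\<integral>\<omega>. \<mu> t * ((\<integral>x. e \<bullet> x \<partial>\<A> t \<omega>) - e \<bullet> u) \<partial>play_law X \<Xi> \<A> \<D> t)"
      by (rule Bochner_Integration.integral_cong[OF refl inner])
    also have "\<dots> = \<mu> t * (mean_action X \<Xi> \<A> \<D> e t - e \<bullet> u)"
      using int by (simp add: mean_action_def P.prob_space)
    finally show ?thesis .
  qed
  have "integrable (play_law X \<Xi> \<A> \<D> T) (\<lambda>\<omega>. F (\<omega> t))" if "t < T" for t
  proof -
    interpret P: prob_space "play_law X \<Xi> \<A> \<D> T" by (rule P)
    note s = sets_play_law[OF \<A> \<D>]
    show ?thesis
    proof (rule P.integrable_const_bound[of _ B])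
      show "AE \<omega> in play_law X \<Xi> \<A> \<D> T. norm (F (\<omega> t)) \<le> B"
        using that F_le sets_eq_imp_space_eq[OF s]
        by (intro AE_I2) (auto simp: history_def space_PiM PiE_iff)
      show "(\<lambda>\<omega>. F (\<omega> t)) \<in> borel_measurable (play_law X \<Xi> \<A> \<D> T)"
        unfolding measurable_cong_sets[OF s refl] history_def
        using that by (intro measurable_compose[OF _ F_meas] measurable_component_singleton) simp
    qed
  qed
  moreover have "regret (linear_loss (2 * M) e) T u = (\<lambda>\<omega>. \<Sum>t<T. F (\<omega> t))"
    by (simp add: fun_eq_iff regret_def F_def grad_linear_loss)
  ultimately show ?thesis
    unfolding expected_regret_def by (simp add: round)
qed

lemma grad_variance_two_point:
  assumes "\<bar>\<mu>\<bar> \<le> M" "norm e = 1" "X \<noteq> {}"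
  shows "grad_variance X (linear_loss (2 * M) e) (two_point M \<mu>) = M\<^sup>2"
  using assms by (simp add: grad_variance_def variance_two_point)

lemma mean_grad_change_two_point:
  assumes "\<bar>\<mu>\<bar> \<le> M" "\<bar>\<mu>'\<bar> \<le> M" "norm e = 1" "X \<noteq> {}"
  shows "(SUP x\<in>X. (norm (mean_grad (linear_loss (2 * M) e) (two_point M \<mu>) x -
    mean_grad (linear_loss (2 * M) e) (two_point M \<mu>') x))\<^sup>2) = (\<mu> - \<mu>')\<^sup>2"
  using assms by (simp add: mean_grad_two_point flip: scaleR_left_diff_distrib)

section \<open>The adversary and the constants\<close>

theorem theorem6:
  fixes X :: "'a::euclidean_space set" and \<sigma> \<Sigma> :: real
  assumes "closed X" "bounded X" "convex X"
    and "diameter X > 0"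
    and "\<sigma> > 0" "\<Sigma> > 0"
  shows "\<exists>T0. \<forall>T\<ge>T0.
    \<forall>alg :: real measure \<Rightarrow> ('a \<Rightarrow> real \<Rightarrow> real) \<Rightarrow> nat \<Rightarrow> (nat \<Rightarrow> 'a \<times> real) \<Rightarrow> 'a measure.
    (\<forall>\<Xi> f. learner_strategy X \<Xi> (alg \<Xi> f)) \<longrightarrow>
    (\<exists>\<Xi> f \<D> G L u.
       differentiable_loss X \<Xi> f \<and>
       adversary_strategy X \<Xi> \<D> \<and>
       (\<forall>t<T. \<forall>\<omega>\<in>space (history X \<Xi> t). admissible X f G L (\<D> t \<omega>)) \<and>
       sigma_bar X \<Xi> f (alg \<Xi> f) \<D> T \<ge> \<sigma> \<and>
       Sigma_bar X \<Xi> f (alg \<Xi> f) \<D> T \<ge> \<Sigma> \<and>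
       u \<in> X \<and>
       expected_regret X \<Xi> f (alg \<Xi> f) \<D> T u \<ge>
         regret_constant * diameter X *
           (sigma_bar X \<Xi> f (alg \<Xi> f) \<D> T + Sigma_bar X \<Xi> f (alg \<Xi> f) \<D> T) * sqrt (real T))"
proof (intro exI[of _ 2] allI impI)
  fix T :: nat
    and alg :: "real measure \<Rightarrow> ('a \<Rightarrow> real \<Rightarrow> real) \<Rightarrow> nat \<Rightarrow> (nat \<Rightarrow> 'a \<times> real) \<Rightarrow> 'a measure"
  \<comment> \<open>A single round would contain no odd round and no change of the mean
    loss.\<close>
  assume "T \<ge> 2" and alg: "\<forall>\<Xi> f. learner_strategy X \<Xi> (alg \<Xi> f)"
  have "X \<noteq> {}" using \<open>diameter X > 0\<close> by auto
  moreover have "compact X" using assms by (simp add: compact_eq_bounded_closed)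
  ultimately obtain a b where ab: "a \<in> X" "b \<in> X" "dist a b = diameter X"
    using diameter_compact_attained by blast
  define d where "d = diameter X"
  have "d > 0" using assms(4) by (simp add: d_def)
  define e where "e = (b - a) /\<^sub>R d"
  have norm_e: "norm e = 1"
    using ab \<open>d > 0\<close> by (simp add: e_def d_def dist_norm norm_minus_commute)
  have e_ab: "e \<bullet> b - e \<bullet> a = d"
  proof -
    have "e \<bullet> b - e \<bullet> a = (norm (b - a))\<^sup>2 / d"
      by (simp add: e_def power2_norm_eq_inner divide_inverse inner_diff_right right_diff_distrib mult.commute)
    also have "norm (b - a) = d"
      using ab(3) by (simp add: d_def dist_norm norm_minus_commute)
    finally show ?thesis using \<open>d > 0\<close> by (simp add: power2_eq_square)
  qed
  \<comment> \<open>The two averages will be \<open>M\<close> and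
    \<open>M * sqrt (1 - 1 / T)\<close>. The latter is at least \<open>M / 2\<close>, hence the
    factor \<open>2\<close>.\<close>
  define M where "M = 2 * (\<sigma> + \<Sigma>)"
  have M: "M > 0" "\<sigma> \<le> M" "\<Sigma> \<le> M / 2"
    using assms by (auto simp: M_def)
  \<comment> \<open>The two-point laws are discrete, so their \<sigma>-algebra is the full power set
    of the reals.\<close>
  define \<Xi> where "\<Xi> = (count_space UNIV :: real measure)"
  define f where "f = linear_loss (2 * M) e"
  \<comment> \<open>The learner may know the sample space and the loss: both are fixed before its
    strategy is inspected, and only the signs respond to it.\<close>
  define \<A> where "\<A> = alg \<Xi> f"
  have \<A>: "learner_strategy X \<Xi> \<A>" using alg by (simp add: \<A>_def)
  define \<mu> :: "(nat \<Rightarrow> real) \<Rightarrow> nat \<Rightarrow> real"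
    where "\<mu> s t = (if odd t then M * s (t div 2) else 0)" for s t
  define \<D> :: "(nat \<Rightarrow> real) \<Rightarrow> nat \<Rightarrow> (nat \<Rightarrow> 'a \<times> real) \<Rightarrow> real measure"
    where "\<D> s = (\<lambda>t _. two_point M (\<mu> s t))" for s
  have \<D>: "adversary_strategy X \<Xi> (\<D> s)" for s
    unfolding \<D>_def \<Xi>_def by (rule adversary_two_point)
  define p where "p s k = mean_action X \<Xi> \<A> (\<D> s) e (2 * k + 1)" for s k
  \<comment> \<open>Measured from this midpoint, the two endpoints lie at \<open>- d / 2\<close> and
    \<open>d / 2\<close> along \<open>e\<close>.\<close>
  define c where "c = (e \<bullet> a + e \<bullet> b) / 2"
  define n where "n = T div 2"
  have "p s k = p s' k" if "\<forall>i<k. s i = s' i" for s s' k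
  proof -
    \<comment> \<open>An odd round before \<open>2 * k + 1\<close> is \<open>2 * j + 1\<close> with
      \<open>j < k\<close>; even rounds use no sign.\<close>
    have "\<D> s i = \<D> s' i" if "i < 2 * k + 1" for i
      using that \<open>\<forall>i<k. s i = s' i\<close> by (auto simp: \<D>_def \<mu>_def elim!: oddE)
    then have "play_law X \<Xi> \<A> (\<D> s) (2 * k + 1) = play_law X \<Xi> \<A> (\<D> s') (2 * k + 1)"
      by (rule play_law_cong[OF \<A> \<D> \<D>])
    then show ?thesis by (simp add: p_def mean_action_def)
  qed
  then obtain s where s: "\<And>k. s k \<in> {-1, 1}" and
    large: "9 / 16 * (d / 2) * sqrt (real n) \<le> (\<Sum>k<n. s k * (p s k - c)) + d / 2 * \<bar>\<Sum>k<n. s k\<bar>"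
    using signs_with_large_sum[of "\<lambda>s k. p s k - c" "d / 2" n] \<open>d > 0\<close> by auto
  have abs_s: "\<bar>s k\<bar> = 1" for k using s[of k] by auto
  have \<mu>_le: "\<bar>\<mu> s t\<bar> \<le> M" for t
    using M by (simp add: \<mu>_def abs_mult abs_s)
  interpret P: prob_space "play_law X \<Xi> \<A> (\<D> s) T"
    by (rule play_law_prob_space[OF \<A> \<D>])
  have dist: "dist_at (\<D> s) t \<omega> = two_point M (\<mu> s t)" for t \<omega>
    by (simp add: dist_at_def \<D>_def)
  have sigma: "sigma_bar X \<Xi> f \<A> (\<D> s) T = M"
    using M \<open>T \<ge> 2\<close> \<open>X \<noteq> {}\<close>
    by (simp add: sigma_bar_def dist f_def grad_variance_two_point \<mu>_le norm_e P.prob_space)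
  \<comment> \<open>Of two consecutive rounds exactly one is odd, with mean \<plusminus>M, and the
    other has mean zero. At \<open>t = 0\<close> the round is compared with itself.\<close>
  have "(\<mu> s t - \<mu> s (t - 1))\<^sup>2 = (if t = 0 then 0 else M\<^sup>2)" for t
    using abs_s by (cases t) (auto simp: \<mu>_def power_mult_distrib abs_square_eq_1)
  then have "(\<Sum>t<T. (\<mu> s t - \<mu> s (t - 1))\<^sup>2) = (real T - 1) * M\<^sup>2"
    using \<open>T \<ge> 2\<close> by (cases T) (simp_all add: sum.lessThan_Suc_shift del: sum.lessThan_Suc)
  then have "Sigma_bar X \<Xi> f \<A> (\<D> s) T = sqrt (1 / real T * ((real T - 1) * M\<^sup>2))"
    using \<open>X \<noteq> {}\<close>
    by (simp add: Sigma_bar_def dist f_def mean_grad_change_two_point \<mu>_le norm_e P.prob_space)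
  also have "1 / real T * ((real T - 1) * M\<^sup>2) = M\<^sup>2 * (1 - 1 / real T)"
    using \<open>T \<ge> 2\<close> by (simp add: field_simps)
  finally have Sigma: "Sigma_bar X \<Xi> f \<A> (\<D> s) T = M * sqrt (1 - 1 / real T)"
    using M by (simp add: real_sqrt_mult)
  have "1 / 2 \<le> sqrt (1 - 1 / real T)"
    using \<open>T \<ge> 2\<close> by (intro real_le_rsqrt) (simp add: field_simps power2_eq_square)
  then have "M * (1 / 2) \<le> M * sqrt (1 - 1 / real T)"
    using M(1) by (intro mult_left_mono) auto
  then have Sigma_ge: "\<Sigma> \<le> Sigma_bar X \<Xi> f \<A> (\<D> s) T"
    using M(3) unfolding Sigma by linarith
  have Sigma_le: "Sigma_bar X \<Xi> f \<A> (\<D> s) T \<le> M"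
    using M unfolding Sigma by (simp add: mult_le_cancel_left1)
  define S where "S = (\<Sum>k<n. s k)"
  \<comment> \<open>The comparator is the endpoint opposite to the prevailing slope.\<close>
  define u where "u = (if S \<ge> 0 then a else b)"
  have "u \<in> X" using ab by (simp add: u_def)
  have u: "S * (c - e \<bullet> u) = d / 2 * \<bar>S\<bar>"
    using e_ab by (auto simp: u_def c_def field_simps)
  have "expected_regret X \<Xi> f \<A> (\<D> s) T u = (\<Sum>t<T. \<mu> s t * (mean_action X \<Xi> \<A> (\<D> s) e t - e \<bullet> u))"
    unfolding f_def \<D>_def \<Xi>_def
    using \<A> assms(2) \<mu>_le by (intro expected_regret_two_point) (simp_all add: \<Xi>_def)
  also have "\<dots> = (\<Sum>t<T. if odd t then M * (s (t div 2) * (p s (t div 2) - e \<bullet> u)) else 0)"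
    by (intro sum.cong refl) (auto simp: \<mu>_def p_def elim!: oddE)
  also have "\<dots> = M * (\<Sum>k<n. s k * (p s k - e \<bullet> u))"
    unfolding n_def sum_distrib_left by (rule sum_odd_rounds)
  \<comment> \<open>Recentring at \<open>c\<close> isolates the comparator's gain, which turns into
    \<open>d / 2 * \<bar>S\<bar>\<close>.\<close>
  also have "(\<Sum>k<n. s k * (p s k - e \<bullet> u)) = (\<Sum>k<n. s k * (p s k - c)) + S * (c - e \<bullet> u)"
    unfolding S_def sum_distrib_right sum.distrib[symmetric] by (simp add: algebra_simps)
  finally have regret: "M * (9 / 32 * d * sqrt (real n)) \<le> expected_regret X \<Xi> f \<A> (\<D> s) T u"
    using large M unfolding u by (simp add: S_def)
  have "sqrt (real T) / 2 \<le> sqrt (real n)"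
  proof (rule real_le_rsqrt)
    \<comment> \<open>Rounding down in \<open>T div 2\<close> costs most at \<open>T = 3\<close>,
      where \<open>n = 1\<close>.\<close>
    have "T \<le> 4 * n" using \<open>T \<ge> 2\<close> by (simp add: n_def)
    then show "(sqrt (real T) / 2)\<^sup>2 \<le> real n"
      by (simp add: power_divide)
  qed
  \<comment> \<open>The target is \<open>1 / 50\<close> because each of the two averages is at most
    \<open>M\<close> and the constant is \<open>1 / 100\<close>; the available \<open>9 / 64\<close>
    exceeds it.\<close>
  moreover have "sqrt (real T) / 50 \<le> 9 / 32 * (sqrt (real T) / 2)"
    by simp
  ultimately have "sqrt (real T) / 50 \<le> 9 / 32 * sqrt (real n)"
    by linarith
  then have "M * d * (sqrt (real T) / 50) \<le> M * d * (9 / 32 * sqrt (real n))"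
    using M \<open>d > 0\<close> by (intro mult_left_mono) auto
  also have "\<dots> = M * (9 / 32 * d * sqrt (real n))"
    by simp
  also note regret
  finally have "M * d * (sqrt (real T) / 50) \<le> expected_regret X \<Xi> f \<A> (\<D> s) T u" .
  moreover have "regret_constant * d * (M + Sigma_bar X \<Xi> f \<A> (\<D> s) T) * sqrt (real T)
      \<le> regret_constant * d * (M + M) * sqrt (real T)"
    using Sigma_le \<open>d > 0\<close> by (intro mult_right_mono mult_left_mono) (auto simp: regret_constant_def)
  ultimately have main: "regret_constant * d * (sigma_bar X \<Xi> f \<A> (\<D> s) T + Sigma_bar X \<Xi> f \<A> (\<D> s) T) * sqrt (real T)
      \<le> expected_regret X \<Xi> f \<A> (\<D> s) T u"
    unfolding sigma by (simp add: regret_constant_def algebra_simps)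
  have "differentiable_loss X \<Xi> f"
    unfolding differentiable_loss_def f_def using GDERIV_linear_loss by blast
  moreover have "admissible X f (2 * M) 0 (\<D> s t \<omega>)" for t \<omega>
    unfolding f_def \<D>_def using \<mu>_le norm_e assms(3) by (rule admissible_two_point)
  ultimately show "\<exists>\<Xi> f \<D> G L u.
       differentiable_loss X \<Xi> f \<and>
       adversary_strategy X \<Xi> \<D> \<and>
       (\<forall>t<T. \<forall>\<omega>\<in>space (history X \<Xi> t). admissible X f G L (\<D> t \<omega>)) \<and>
       sigma_bar X \<Xi> f (alg \<Xi> f) \<D> T \<ge> \<sigma> \<and>
       Sigma_bar X \<Xi> f (alg \<Xi> f) \<D> T \<ge> \<Sigma> \<and>
       u \<in> X \<and>
       expected_regret X \<Xi> f (alg \<Xi> f) \<D> T u \<ge>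
         regret_constant * diameter X *
           (sigma_bar X \<Xi> f (alg \<Xi> f) \<D> T + Sigma_bar X \<Xi> f (alg \<Xi> f) \<D> T) * sqrt (real T)"
    using \<D>[of s] sigma M(2) Sigma_ge \<open>u \<in> X\<close> main unfolding \<A>_def d_def
    by (intro exI[of _ \<Xi>] exI[of _ f] exI[of _ "\<D> s"] exI[of _ "2 * M"] exI[of _ 0] exI[of _ u]) simp
qed

end
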